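(* For every $t\in[0,T]$, $\mathcal{R}_t=\{\bm{x}\in\mathbb{R}^n\mid u(\bm{x},t)\le0\}$, where $\mathcal{R}_t$ is the backward reachable set at time $t$ of the polynomial system $\dot{\bm{x}}=\bm{f}(\bm{x},\bm{d})$ and $u$ is the value function of the auxiliary system $\dot{\bm{x}}=\bm{F}(\bm{x},\bm{d})$, as defined in the context.
   Context: Setting. $n,m$ are positive integers, $T>0$. $\bm{f}:\mathbb{R}^n\times\mathbb{R}^m\to\mathbb{R}^n$ has polynomial components $f_i\in\mathbb{R}[\bm{x},\bm{d}]$. $\mathcal{D}\subset\mathbb{R}^m$ is a (nonempty) compact basic semi-algebraic set. For $t\in[0,T]$, $\mathcal{X}_t=\{\bm{x}\in\mathbb{R}^n\mid g_i(\bm{x},t)\le0,\ i=1,\dots,n_{\mathcal{X}}\}$ is compact, with $g_i\in\mathbb{R}[\bm{x},t]$ and $\partial\mathcal{X}_t=\bigcup_{i}\{\bm{x}\in\mathcal{X}_t\mid g_i(\bm{x},t)=0\}$. The target is $\mathtt{TR}=\{\bm{x}\in\mathbb{R}^n\mid l_i(\bm{x})\le0,\ i=1,\dots,n_{\mathtt{TR}}\}$ with $l_i\in\mathbb{R}[\bm{x}]$ and $\partial\mathtt{TR}=\bigcup_i\{\bm{x}\in\mathtt{TR}\mid l_i(\bm{x})=0\}$. $R>0$ is a number and $B(\bm{0},R)=\{\bm{x}\in\mathbb{R}^n\mid R-\sum_{i=1}^n x_i^2\ge0\}$, chosen so that for all $t\in[0,T]$: $\mathcal{X}_t\subseteq B(\bm{0},R)$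 and $\partial\mathcal{X}_t\cap\partial B(\bm{0},R)=\emptyset$. $\bm{F}:\mathbb{R}^n\times\mathcal{D}\to\mathbb{R}^n$ is a continuous map, globally Lipschitz in $\bm{x}\in\mathbb{R}^n$ uniformly in $\bm{d}\in\mathcal{D}$, with $\bm{F}=\bm{f}$ on $B(\bm{0},R)\times\mathcal{D}$. $\mathcal{M}_t$ is the set of measurable functions $\bm{d}:[t,T]\to\mathcal{D}$. For $\bm{d}\in\mathcal{M}_t$, $\bm{y}_{\bm{x},t}^{\bm{d}}$ is the (absolutely continuous) solution of $\dot{\bm{x}}(s)=\bm{f}(\bm{x}(s),\bm{d}(s))$ a.e. with value $\bm{x}$ at time $t$, and $\bm{\phi}_{\bm{x},t}^{\bm{d}}:[t,T]\to\mathbb{R}^n$ is the solution of $\dot{\bm{x}}(s)=\bm{F}(\bm{x}(s),\bm{d}(s))$ a.e. with value $\bm{x}$ at time $t$. Backward reachable set at time $t$: $\mathcal{R}_t=\{\bm{x}\in\mathbb{R}^n\mid \forall\bm{d}\in\mathcal{M}_t:\ \bm{y}_{\bm{x},t}^{\bm{d}}(s)\in\mathcal{X}_s\ \forall s\in[t,T]\text{ and }\bm{y}_{\bm{x},t}^{\bm{d}}(T)\in\mathtt{TR}\}$ (in particular the solution is required to exist on $[t,T]$). Value function: for $(\bm{x},t)\in\mathbb{R}^n\times[0,T]$, \[u(\bm{x},t)=\sup_{\bm{d}\in\mathcal{M}_t}\max\Big\{\max_{i}l_i(\bm{\phi}_{\bm{x},t}^{\bm{d}}(T)),\ \max_{i}\max_{s\in[t,T]}g_i(\bm{\phi}_{\bm{x},t}^{\bm{d}}(s),s)\Big\}.\]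 *)

theory Defs
  imports "HOL-Analysis.Analysis"
begin

definition basic_semialgebraic :: "'a::euclidean_space set \<Rightarrow> bool" where
  "basic_semialgebraic S \<longleftrightarrow>
     (\<exists>(k::nat) h. (\<forall>i\<in>{1..k}. real_polynomial_function (h i)) \<and> S = {x. \<forall>i\<in>{1..k}. h i x \<le> 0})"

text \<open>Absolute continuity of a curve: \<open>P\<close> ranges over finite families of non-overlapping
  subintervals \<open>[a,b]\<close> of \<open>S\<close>, encoded by their pairs of endpoints.\<close>

definition absolutely_continuous_curve :: "real set \<Rightarrow> (real \<Rightarrow> 'a::real_normed_vector) \<Rightarrow> bool" where
  "absolutely_continuous_curve S y \<longleftrightarrow>
     (\<forall>\<epsilon>>0. \<exists>\<delta>>0. \<forall>P. finite P \<and> (\<forall>(a, b)\<in>P. a \<le> b \<and> {a..b} \<subseteq> S) \<and>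
        disjoint_family_on (\<lambda>(a, b). {a<..<b}) P \<and> (\<Sum>(a, b)\<in>P. b - a) < \<delta>
        \<longrightarrow> (\<Sum>(a, b)\<in>P. norm (y b - y a)) < \<epsilon>)"

text \<open>The values of a control outside \<open>[t,T]\<close> are irrelevant and left unconstrained;
  measurability is Lebesgue measurability.\<close>

definition controls :: "'d::euclidean_space set \<Rightarrow> real \<Rightarrow> real \<Rightarrow> (real \<Rightarrow> 'd) set" where
  "controls D T t = borel_measurable (lebesgue_on {t..T}) \<inter> ({t..T} \<rightarrow> D)"

definition is_solution ::
  "('a::euclidean_space \<Rightarrow> 'd \<Rightarrow> 'a) \<Rightarrow> real \<Rightarrow> 'a \<Rightarrow> real \<Rightarrow> (real \<Rightarrow> 'd) \<Rightarrow> (real \<Rightarrow> 'a) \<Rightarrow> bool" where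
  "is_solution h T x t d y \<longleftrightarrow>
     absolutely_continuous_curve {t..T} y \<and> y t = x \<and>
     (AE s in lebesgue_on {t..T}. (y has_vector_derivative h (y s) (d s)) (at s within {t..T}))"

text \<open>Extensionality on \<open>[t,T]\<close> removes the arbitrary values elsewhere, so that the solution of a
  globally Lipschitz system is unique as a HOL function.\<close>

definition solution ::
  "('a::euclidean_space \<Rightarrow> 'd \<Rightarrow> 'a) \<Rightarrow> real \<Rightarrow> 'a \<Rightarrow> real \<Rightarrow> (real \<Rightarrow> 'd) \<Rightarrow> real \<Rightarrow> 'a" where
  "solution h T x t d = (THE y. y \<in> extensional {t..T} \<and> is_solution h T x t d y)"

definition constraint_set :: "nat \<Rightarrow> (nat \<Rightarrow> 'a \<Rightarrow> real \<Rightarrow> real) \<Rightarrow> real \<Rightarrow> 'a set" where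
  "constraint_set nX g t = {x. \<forall>i\<in>{1..nX}. g i x t \<le> 0}"

definition target_set :: "nat \<Rightarrow> (nat \<Rightarrow> 'a \<Rightarrow> real) \<Rightarrow> 'a set" where
  "target_set nTR l = {x. \<forall>i\<in>{1..nTR}. l i x \<le> 0}"

text \<open>Note the convention: the Euclidean radius of this ball is \<open>sqrt R\<close>.\<close>

definition enclosing_ball :: "real \<Rightarrow> (real ^ 'n) set" where
  "enclosing_ball R = {x. R - (\<Sum>i\<in>UNIV. (x $ i)\<^sup>2) \<ge> 0}"

definition backward_reachable ::
  "('a::euclidean_space \<Rightarrow> 'd::euclidean_space \<Rightarrow> 'a) \<Rightarrow> 'd set \<Rightarrow> real \<Rightarrow> (real \<Rightarrow> 'a set) \<Rightarrow> 'a set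
    \<Rightarrow> real \<Rightarrow> 'a set" where
  "backward_reachable f D T X TR t =
     {x. \<forall>d\<in>controls D T t. \<exists>y. is_solution f T x t d y \<and> (\<forall>s\<in>{t..T}. y s \<in> X s) \<and> y T \<in> TR}"

definition value_function ::
  "('a::euclidean_space \<Rightarrow> 'd::euclidean_space \<Rightarrow> 'a) \<Rightarrow> 'd set \<Rightarrow> real
    \<Rightarrow> nat \<Rightarrow> (nat \<Rightarrow> 'a \<Rightarrow> real \<Rightarrow> real) \<Rightarrow> nat \<Rightarrow> (nat \<Rightarrow> 'a \<Rightarrow> real) \<Rightarrow> 'a \<Rightarrow> real \<Rightarrow> real" where
  "value_function F D T nX g nTR l x t =
     (SUP d\<in>controls D T t.
        max (MAX i\<in>{1..nTR}. l i (solution F T x t d T))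
            (MAX i\<in>{1..nX}. SUP s\<in>{t..T}. g i (solution F T x t d s) s))"

end

theory Submission
  imports Defs
begin

text \<open>As long as a trajectory stays in the sets \<open>X_s\<close> it stays in the ball, where \<open>f\<close> and \<open>F\<close> agree, so
  it solves the polynomial system iff it solves the auxiliary one. The auxiliary system has exactly
  one solution for every control, and these solutions are bounded uniformly in the control, so that
  the suprema in the value function are finite and \<open>u x t \<le> 0\<close> says precisely that no constraint is
  violated by any control. The analytic core is the equivalence of absolutely continuous solutions
  with solutions of the integral equation.\<close>

text \<open>A control is merely measurable, so the right-hand side may be discontinuous in time and
  a trajectory is differentiable only almost everywhere. The integral equation holds at every time
  and supports both Gronwall and a fixed-point argument. Passing to it and back takes the two halves
  of Lebesgue's theorem: an absolutely continuous curve is the integral of its derivative, and an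
  indefinite integral has its integrand as derivative almost everywhere. The polynomial system may
  blow up before \<open>T\<close>, so its solutions are never constructed directly; they are read
  off from the auxiliary flow. Both sides of the comparison assume viability on all of
  \<open>[t,T]\<close>, which spares any first-exit argument. A real supremum is informative only
  for nonempty families bounded above. Once this is secured, the sign condition passes through
  \<open>SUP\<close> and \<open>MAX\<close> one control at a time, without any optimal
  control.\<close>

hide_const (open) Polynomial.content

section \<open>Absolutely continuous curves and Lebesgue differentiation\<close>

text \<open>Two cells meet in a convex set with empty interior, hence in a null set, so the contents
  add up to the measure of the union. This turns a small open set around an exceptional set into a
  bound on the total length of the cells tagged there.\<close>

lemma tagged_partial_division_content_le:
  fixes S U :: "'a::euclidean_space set"
  assumes q: "q tagged_partial_division_of S"
    and U: "\<And>x K. (x, K) \<in> q \<Longrightarrow> K \<subseteq> U" "U \<in> lmeasurable"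
  shows "(\<Sum>(x, K)\<in>q. content K) \<le> measure lebesgue U"
proof -
  note qD = tagged_partial_division_ofD[OF q]
  have box: "\<exists>a b. snd p = cbox a b" if "p \<in> q" for p
    using qD(4) that by (metis prod.collapse)
  have "(\<Sum>(x, K)\<in>q. content K) = (\<Sum>p\<in>q. measure lebesgue (snd p))"
    by (rule sum.cong) (use box in \<open>force simp: case_prod_unfold\<close>)+
  also have "\<dots> = measure lebesgue (\<Union>(snd ` q))"
  proof (rule measure_negligible_finite_Union_image[symmetric])
    show "snd p \<in> lmeasurable" if "p \<in> q" for p
      using box[OF that] by auto
    show "pairwise (\<lambda>p p'. negligible (snd p \<inter> snd p')) q"
    proof (rule pairwiseI)
      fix p p' assume p: "p \<in> q" "p' \<in> q" "p \<noteq> p'"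
      then have "interior (snd p \<inter> snd p') = {}"
        using qD(5) by (metis interior_Int prod.collapse)
      moreover have "convex (snd p \<inter> snd p')"
        using box p by (metis convex_Int convex_box(1))
      ultimately show "negligible (snd p \<inter> snd p')"
        by (simp add: negligible_convex_interior)
    qed
  qed (use qD in auto)
  also have "\<dots> \<le> measure lebesgue U"
  proof (rule measure_mono_fmeasurable)
    show "\<Union>(snd ` q) \<subseteq> U" using U(1) by fastforce
    show "\<Union>(snd ` q) \<in> sets lebesgue"
      using box qD(1) by (intro sets.finite_UN) fastforce+
  qed fact
  finally show ?thesis .
qed

lemma absolutely_continuous_curveE:
  assumes "absolutely_continuous_curve S y" "e > 0"
  obtains \<delta> where "\<delta> > 0"
    "\<And>P. finite P \<Longrightarrow> (\<And>a b. (a, b) \<in> P \<Longrightarrow> a \<le> b \<and> {a..b} \<subseteq> S) \<Longrightarrow>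
       disjoint_family_on (\<lambda>(a, b). {a<..<b}) P \<Longrightarrow> (\<Sum>(a, b)\<in>P. b - a) < \<delta> \<Longrightarrow>
       (\<Sum>(a, b)\<in>P. norm (y b - y a)) < e"
proof -
  obtain \<delta> where "\<delta> > 0" and \<delta>: "\<forall>P. finite P \<and> (\<forall>(a, b)\<in>P. a \<le> b \<and> {a..b} \<subseteq> S) \<and>
      disjoint_family_on (\<lambda>(a, b). {a<..<b}) P \<and> (\<Sum>(a, b)\<in>P. b - a) < \<delta>
        \<longrightarrow> (\<Sum>(a, b)\<in>P. norm (y b - y a)) < e"
    using assms(1)[unfolded absolutely_continuous_curve_def, THEN spec, THEN mp, OF assms(2)]
    by (elim exE conjE)
  show thesis
    by (rule that[OF \<open>\<delta> > 0\<close>], rule \<delta>[THEN spec, THEN mp], intro conjI) auto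
qed

lemma absolutely_continuous_curveI:
  assumes "\<And>e. e > 0 \<Longrightarrow> \<exists>\<delta>>0. \<forall>P. finite P \<longrightarrow> (\<forall>a b. (a, b) \<in> P \<longrightarrow> a \<le> b \<and> {a..b} \<subseteq> S) \<longrightarrow>
       disjoint_family_on (\<lambda>(a, b). {a<..<b}) P \<longrightarrow> (\<Sum>(a, b)\<in>P. b - a) < \<delta> \<longrightarrow>
       (\<Sum>(a, b)\<in>P. norm (y b - y a)) < e"
  shows "absolutely_continuous_curve S y"
  unfolding absolutely_continuous_curve_def
proof (intro allI impI)
  fix e :: real assume "e > 0"
  then obtain \<delta> where "\<delta> > 0" and \<delta>: "\<forall>P. finite P \<longrightarrow> (\<forall>a b. (a, b) \<in> P \<longrightarrow> a \<le> b \<and> {a..b} \<subseteq> S) \<longrightarrow>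
       disjoint_family_on (\<lambda>(a, b). {a<..<b}) P \<longrightarrow> (\<Sum>(a, b)\<in>P. b - a) < \<delta> \<longrightarrow>
       (\<Sum>(a, b)\<in>P. norm (y b - y a)) < e"
    using assms by blast
  show "\<exists>\<delta>>0. \<forall>P. finite P \<and> (\<forall>(a, b)\<in>P. a \<le> b \<and> {a..b} \<subseteq> S) \<and>
      disjoint_family_on (\<lambda>(a, b). {a<..<b}) P \<and> (\<Sum>(a, b)\<in>P. b - a) < \<delta>
        \<longrightarrow> (\<Sum>(a, b)\<in>P. norm (y b - y a)) < e"
    by (intro exI[of _ \<delta>] conjI allI impI \<open>\<delta> > 0\<close>, elim conjE, rule \<delta>[rule_format]) auto
qed

text \<open>Bridge from families of endpoint pairs to the cells of gauge integration. The definition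
  sums over a set of pairs, so the delicate point is that distinct tagged cells must not be
  merged.\<close>

lemma absolutely_continuous_curve_tagged:
  assumes y: "absolutely_continuous_curve S y" and "e > 0"
  obtains \<delta> where "\<delta> > 0"
    "\<And>q. q tagged_partial_division_of S \<Longrightarrow> (\<Sum>(x, K)\<in>q. content K) < \<delta> \<Longrightarrow>
       (\<Sum>(x, K)\<in>q. norm (y (Sup K) - y (Inf K))) < e"
proof -
  obtain \<delta> where "\<delta> > 0" and \<delta>: "\<And>P. finite P \<Longrightarrow> (\<And>a b. (a, b) \<in> P \<Longrightarrow> a \<le> b \<and> {a..b} \<subseteq> S) \<Longrightarrow>
       disjoint_family_on (\<lambda>(a, b). {a<..<b}) P \<Longrightarrow> (\<Sum>(a, b)\<in>P. b - a) < \<delta> \<Longrightarrow>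
       (\<Sum>(a, b)\<in>P. norm (y b - y a)) < e"
    using absolutely_continuous_curveE[OF assms] by blast
  show thesis
  proof (rule that[OF \<open>\<delta> > 0\<close>])
    fix q assume q: "q tagged_partial_division_of S" and small: "(\<Sum>(x, K)\<in>q. content K) < \<delta>"
    note qD = tagged_partial_division_ofD[OF q]
    define ends where "ends = (\<lambda>(x::real, K). (Inf K :: real, Sup K))"
    have box: "\<exists>u v. K = {u..v} \<and> u \<le> x \<and> x \<le> v" if xK: "(x, K) \<in> q" for x K
      using qD(2)[OF xK] qD(4)[OF xK] by (auto simp: cbox_interval)
    have endsI: "\<exists>u v. K = {u..v} \<and> u \<le> x \<and> x \<le> v \<and> ends (x, K) = (u, v)" if "(x, K) \<in> q" for x K
      using box[OF that] by (auto simp: ends_def)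
    \<comment> \<open>Distinct nondegenerate cells with equal endpoints would overlap in their
      interiors; a degenerate cell consists of its tag alone, so there the endpoints determine the
      tag.\<close>
    have inj: "inj_on ends q"
    proof (rule inj_onI, clarify)
      fix x K x' K' assume in_q: "(x, K) \<in> q" "(x', K') \<in> q" and eq: "ends (x, K) = ends (x', K')"
      obtain u v where uv: "K = {u..v}" "K' = {u..v}" "u \<le> x" "x \<le> v" "u \<le> x'" "x' \<le> v"
        using endsI[OF in_q(1)] endsI[OF in_q(2)] eq by auto
      show "x = x' \<and> K = K'"
      proof (cases "u = v")
        case False
        then have "interior K \<inter> interior K' \<noteq> {}"
          using uv by (simp add: interior_atLeastAtMost_real)
        then show ?thesis using qD(5)[OF in_q] by blast
      qed (use uv in simp)
    qed
    have "(\<Sum>(a, b)\<in>ends ` q. norm (y b - y a)) < e"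
    proof (rule \<delta>)
      show "finite (ends ` q)" using qD(1) by simp
      fix a b assume "(a, b) \<in> ends ` q"
      then obtain x K where xK: "(x, K) \<in> q" and "(a, b) = ends (x, K)" by fast
      then show "a \<le> b \<and> {a..b} \<subseteq> S" using endsI[OF xK] qD(3)[OF xK] by auto
    next
      show "disjoint_family_on (\<lambda>(a, b). {a<..<b}) (ends ` q)"
        unfolding disjoint_family_on_def
      proof (intro ballI impI)
        fix m m' assume "m \<in> ends ` q" "m' \<in> ends ` q" and "m \<noteq> m'"
        then obtain x K x' K' where in_q: "(x, K) \<in> q" "(x', K') \<in> q"
          and m: "m = ends (x, K)" "m' = ends (x', K')" and ne: "ends (x, K) \<noteq> ends (x', K')"
          by fast
        obtain u v where uv: "K = {u..v}" "ends (x, K) = (u, v)" using endsI[OF in_q(1)] by blast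
        obtain u' v' where uv': "K' = {u'..v'}" "ends (x', K') = (u', v')" using endsI[OF in_q(2)] by blast
        have "interior K \<inter> interior K' = {}" using qD(5)[OF in_q] ne by blast
        then show "(case m of (a, b) \<Rightarrow> {a<..<b}) \<inter> (case m' of (a, b) \<Rightarrow> {a<..<b}) = {}"
          using uv uv' m by (simp add: interior_atLeastAtMost_real)
      qed
      have "(\<Sum>(a, b)\<in>ends ` q. b - a) = (\<Sum>(x, K)\<in>q. content K)"
        unfolding sum.reindex[OF inj]
      proof (rule sum.cong)
        fix r assume "r \<in> q"
        then show "((\<lambda>(a, b). b - a) \<circ> ends) r = (case r of (x, K) \<Rightarrow> content K)"
          using endsI[of "fst r" "snd r"] by (auto simp: case_prod_unfold)
      qed simp
      then show "(\<Sum>(a, b)\<in>ends ` q. b - a) < \<delta>" using small by simp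
    qed
    then show "(\<Sum>(x, K)\<in>q. norm (y (Sup K) - y (Inf K))) < e"
      unfolding sum.reindex[OF inj] by (simp add: ends_def case_prod_unfold o_def)
  qed
qed

text \<open>Intervals tagged in the exceptional set \<open>N\<close> lie in an open set of small measure, so absolute
  continuity makes their contribution to the Riemann sum negligible.\<close>

theorem fundamental_theorem_of_calculus_absolutely_continuous:
  fixes y :: "real \<Rightarrow> 'a::banach"
  assumes "a \<le> b" and ac: "absolutely_continuous_curve {a..b} y" and N: "negligible N"
    and der: "\<And>x. x \<in> {a..b} - N \<Longrightarrow> (y has_vector_derivative y' x) (at x within {a..b})"
  shows "(y' has_integral (y b - y a)) {a..b}"
proof (rule has_integral_spike[OF N])
  let ?z = "\<lambda>x. if x \<in> N then 0 else y' x"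
  show "y' x = ?z x" if "x \<in> {a..b} - N" for x using that by simp
  show "(?z has_integral (y b - y a)) {a..b}"
    unfolding has_integral_real
  proof (intro allI impI)
    fix e :: real assume "e > 0"
    \<comment> \<open>The summand 2 keeps \<open>c\<close> positive and \<open>c * (b - a)\<close>
      strictly below \<open>e / 2\<close> even for \<open>a = b\<close>. The other half of
      \<open>e\<close> is reserved for the cells tagged in \<open>N\<close>.\<close>
    define c where "c = e / (2 * (b - a) + 2)"
    have c: "c > 0" "c * (b - a) < e / 2"
      using \<open>a \<le> b\<close> \<open>e > 0\<close> by (auto simp: c_def field_simps)
    obtain \<delta> where "\<delta> > 0" and \<delta>:
      "\<And>q. q tagged_partial_division_of {a..b} \<Longrightarrow> (\<Sum>(x, K)\<in>q. content K) < \<delta> \<Longrightarrow>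
       (\<Sum>(x, K)\<in>q. norm (y (Sup K) - y (Inf K))) < e / 2"
      using absolutely_continuous_curve_tagged[OF ac, of "e / 2"] \<open>e > 0\<close> by auto
    obtain U where U: "open U" "N \<subseteq> U" "U \<in> lmeasurable" "measure lebesgue U < \<delta>"
    proof -
      have N0: "N \<in> null_sets lebesgue" using N by (simp add: negligible_iff_null_sets)
      then obtain U where U: "open U" "N \<subseteq> U" "U - N \<in> lmeasurable" "emeasure lebesgue (U - N) < ennreal \<delta>"
        using sets_lebesgue_outer_open[of N \<delta>] \<open>\<delta> > 0\<close> by blast
      have "emeasure lebesgue U = emeasure lebesgue (U - N)"
        using N0 U(1) by (simp add: emeasure_Diff_null_set borel_open)
      then have "emeasure lebesgue U < ennreal \<delta>" using U by simp
      moreover from this have Um: "U \<in> lmeasurable"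
        using U(1) order.strict_trans[OF _ ennreal_less_top] by (intro fmeasurableI) (simp_all add: borel_open)
      ultimately have "measure lebesgue U < \<delta>"
        by (simp add: emeasure_eq_measure2 ennreal_less_iff)
      with U Um that show thesis by blast
    qed
    have "\<exists>d>0. x \<in> {a..b} - N \<longrightarrow>
         (\<forall>z\<in>{a..b}. norm (z - x) < d \<longrightarrow> norm (y z - y x - (z - x) *\<^sub>R y' x) \<le> c * norm (z - x))" for x
    proof (cases "x \<in> {a..b} - N")
      case True
      then show ?thesis
        using der[OF True] c(1) unfolding has_vector_derivative_def has_derivative_within_alt by blast
    qed (use zero_less_one in blast)
    then obtain d where d: "\<And>x. 0 < d x"
        "\<And>x z. \<lbrakk>x \<in> {a..b} - N; z \<in> {a..b}; norm (z - x) < d x\<rbrakk>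
                \<Longrightarrow> norm (y z - y x - (z - x) *\<^sub>R y' x) \<le> c * norm (z - x)"
      by metis
    \<comment> \<open>Cells tagged in \<open>N\<close> are forced into \<open>U\<close>; every other
      cell stays where the linear approximation at its tag has relative error at most
      \<open>c\<close>.\<close>
    define \<gamma> where "\<gamma> = (\<lambda>x. if x \<in> N then U else ball x (d x))"
    have gauge: "gauge \<gamma>" using U d(1) by (auto simp: gauge_def \<gamma>_def)
    have less: "norm ((\<Sum>(x, K)\<in>p. content K *\<^sub>R ?z x) - (y b - y a)) < e"
      if p: "p tagged_division_of {a..b}" and fine: "\<gamma> fine p" for p
    proof -
      have pp: "p tagged_partial_division_of {a..b}" using p by (simp add: tagged_division_of_def)
      note pD = tagged_partial_division_ofD[OF pp]
      define q where "q = {(x, K) \<in> p. x \<in> N}"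
      let ?E = "\<lambda>(x, K). content K *\<^sub>R ?z x - (y (Sup K) - y (Inf K))"
      have q: "q \<subseteq> p" "q tagged_partial_division_of {a..b}"
        using tagged_partial_division_subset[OF pp, of q] by (auto simp: q_def)
      have sums: "b - a = (\<Sum>(x, K)\<in>p. Sup K - Inf K)" "y b - y a = (\<Sum>(x, K)\<in>p. y (Sup K) - y (Inf K))"
        using additive_tagged_division_1[OF \<open>a \<le> b\<close> p, of "\<lambda>x. x"]
          additive_tagged_division_1[OF \<open>a \<le> b\<close> p, of y] by auto
      have box: "\<exists>u v. K = {u..v} \<and> u \<le> x \<and> x \<le> v \<and> a \<le> u \<and> v \<le> b" if "(x, K) \<in> p" for x K
        using pD(2-4)[OF that] by fastforce
      have "(\<Sum>(x, K)\<in>q. content K) \<le> measure lebesgue U"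
      proof (rule tagged_partial_division_content_le[OF q(2) _ U(3)])
        show "K \<subseteq> U" if "(x, K) \<in> q" for x K
          using fine that by (auto simp: q_def \<gamma>_def dest!: fineD)
      qed
      then have "(\<Sum>(x, K)\<in>q. norm (y (Sup K) - y (Inf K))) < e / 2"
        using \<delta> q U by simp
      \<comment> \<open>On \<open>q\<close> the modified integrand \<open>?z\<close> is 0, so only
        the increments of \<open>y\<close> remain.\<close>
      moreover have "(\<Sum>p\<in>q. norm (?E p)) = (\<Sum>(x, K)\<in>q. norm (y (Sup K) - y (Inf K)))"
        by (rule sum.cong) (auto simp: q_def norm_minus_commute)
      moreover have "(\<Sum>r\<in>p - q. norm (?E r)) \<le> (\<Sum>(x, K)\<in>p - q. c * (Sup K - Inf K))"
      proof (rule sum_mono, clarify)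
        fix x K assume xK: "(x, K) \<in> p" "(x, K) \<notin> q"
        then obtain u v where K: "K = {u..v}" "u \<le> x" "x \<le> v" "a \<le> u" "v \<le> b" using box by blast
        have x: "x \<notin> N" and Kb: "K \<subseteq> ball x (d x)"
          using xK fine by (auto simp: q_def \<gamma>_def dest!: fineD)
        have "u \<in> K" "v \<in> K" using K by auto
        with Kb have uv: "norm (u - x) < d x" "norm (v - x) < d x"
          by (auto simp: dist_norm norm_minus_commute)
        \<comment> \<open>Straddling: the tag lies between \<open>u\<close> and \<open>v\<close>, so
          the errors on its two sides add up to exactly \<open>c * (v - u)\<close>.\<close>
        have "norm ((v - u) *\<^sub>R y' x - (y v - y u))
            = norm ((y u - y x - (u - x) *\<^sub>R y' x) - (y v - y x - (v - x) *\<^sub>R y' x))"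
          by (simp add: algebra_simps)
        also have "\<dots> \<le> norm (y u - y x - (u - x) *\<^sub>R y' x) + norm (y v - y x - (v - x) *\<^sub>R y' x)"
          by (rule norm_triangle_ineq4)
        also have "\<dots> \<le> c * norm (u - x) + c * norm (v - x)"
          using K x uv by (intro add_mono d(2)) auto
        also have "\<dots> = c * (v - u)" using K by (simp add: algebra_simps)
        finally show "norm (content K *\<^sub>R ?z x - (y (Sup K) - y (Inf K))) \<le> c * (Sup K - Inf K)"
          using K x by simp
      qed
      moreover have "(\<Sum>(x, K)\<in>p - q. c * (Sup K - Inf K)) \<le> (\<Sum>(x, K)\<in>p. c * (Sup K - Inf K))"
      proof (rule sum_mono2)
        fix r assume "r \<in> p - (p - q)"
        then show "0 \<le> (case r of (x, K) \<Rightarrow> c * (Sup K - Inf K))"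
          using box c(1) by (cases r) fastforce
      qed (use pD in auto)
      moreover have "(\<Sum>(x, K)\<in>p. c * (Sup K - Inf K)) = c * (b - a)"
        unfolding sums(1) sum_distrib_left by (simp add: case_prod_unfold)
      moreover have "(\<Sum>r\<in>p. norm (?E r)) = (\<Sum>r\<in>p - q. norm (?E r)) + (\<Sum>r\<in>q. norm (?E r))"
        using sum.subset_diff[OF q(1) pD(1)] .
      moreover have "norm ((\<Sum>(x, K)\<in>p. content K *\<^sub>R ?z x) - (y b - y a)) \<le> (\<Sum>r\<in>p. norm (?E r))"
        unfolding sums(2) sum_subtractf[symmetric] by (rule order_trans[OF _ norm_sum]) (simp add: case_prod_unfold)
      ultimately show ?thesis using c(2) by linarith
    qed
    show "\<exists>\<gamma>. gauge \<gamma> \<and> (\<forall>p. p tagged_division_of {a..b} \<and> \<gamma> fine p \<longrightarrow>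
        norm ((\<Sum>(x, K)\<in>p. content K *\<^sub>R ?z x) - (y b - y a)) < e)"
    proof (intro exI[of _ \<gamma>] conjI allI impI gauge)
      fix p assume "p tagged_division_of {a..b} \<and> \<gamma> fine p"
      then show "norm ((\<Sum>(x, K)\<in>p. content K *\<^sub>R ?z x) - (y b - y a)) < e"
        by (elim conjE) (rule less)
    qed
  qed
qed

text \<open>Where the difference quotient stays \<open>1 / Suc k\<close> away from \<open>h\<close>, arbitrarily short intervals
  witness this. The Henstock lemma bounds the total length of any disjoint family of them, and the
  Vitali covering theorem selects a family covering almost all of the set.\<close>

theorem indefinite_integral_has_vector_derivative_ae:
  fixes h :: "real \<Rightarrow> 'a::euclidean_space"
  assumes h: "h integrable_on {a..b}"
  obtains N where "negligible N"
    "\<And>x. x \<in> {a..b} - N \<Longrightarrow> ((\<lambda>s. integral {a..s} h) has_vector_derivative h x) (at x within {a..b})"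
proof -
  define G where "G = (\<lambda>s. integral {a..s} h)"
  have G: "G v - G u = integral {u..v} h" if "a \<le> u" "u \<le> v" "v \<le> b" for u v
    using Henstock_Kurzweil_Integration.integral_combine[of a u v h] that
      integrable_subinterval_real[OF h, of a v] by (simp add: G_def algebra_simps)
  define E where "E k = {x \<in> {a..b}. \<forall>d>0. \<exists>z\<in>{a..b}. \<bar>z - x\<bar> < d \<and>
      norm (G z - G x - (z - x) *\<^sub>R h x) > \<bar>z - x\<bar> / real (Suc k)}" for k
  have "negligible (E k)" for k
    unfolding negligible_outer_le
  proof (intro allI impI)
    fix e :: real assume "e > 0"
    \<comment> \<open>The tolerance is divided by \<open>Suc k\<close> because the length of a bad
      interval is bounded by \<open>Suc k\<close> times its Henstock error.\<close>
    then obtain \<gamma> where "gauge \<gamma>" and \<gamma>: "\<And>p. \<lbrakk>p tagged_partial_division_of (cbox a b); \<gamma> fine p\<rbrakk> \<Longrightarrow>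
             (\<Sum>(x, K)\<in>p. norm (content K *\<^sub>R h x - integral K h)) < e / real (Suc k)"
      using Henstock_lemma[of h a b "e / real (Suc k)"] h by auto
    \<comment> \<open>A triple is a tag with the endpoints of a bad interval that is fine for the
      gauge. Strictness \<open>u < v\<close> gives the positive radius needed for the covering;
      \<open>?c\<close> and \<open>?r\<close> present the interval as a ball.\<close>
    define I where "I = {(x, u, v). a \<le> u \<and> v \<le> b \<and> u < v \<and> x \<in> {u..v} \<and> {u..v} \<subseteq> \<gamma> x \<and>
      norm ((v - u) *\<^sub>R h x - (G v - G u)) > (v - u) / real (Suc k)}"
    let ?c = "\<lambda>(x::real, u::real, v::real). (u + v) / 2" and ?r = "\<lambda>(x::real, u::real, v::real). (v - u) / 2"
    have cball: "cball ((u + v) / 2) ((v - u) / 2) = {u..v}" for u v :: real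
      by (simp add: cball_eq_atLeastAtMost field_simps)
    obtain C where C: "countable C" "C \<subseteq> I"
      "pairwise (\<lambda>i j. disjnt (cball (?c i) (?r i)) (cball (?c j) (?r j))) C"
      "negligible (E k - (\<Union>i\<in>C. cball (?c i) (?r i)))"
    proof (rule Vitali_covering_theorem_cballs[of I ?r "E k" ?c])
      show "0 < ?r i" if "i \<in> I" for i using that by (auto simp: I_def)
      show "\<exists>i. i \<in> I \<and> x \<in> cball (?c i) (?r i) \<and> ?r i < d" if x: "x \<in> E k" and "0 < d" for x d
      proof -
        obtain \<rho> where \<rho>: "\<rho> > 0" "ball x \<rho> \<subseteq> \<gamma> x"
          using \<open>gauge \<gamma>\<close> by (meson gauge_def openE)
        have "\<forall>d>0. \<exists>z\<in>{a..b}. \<bar>z - x\<bar> < d \<and>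
            norm (G z - G x - (z - x) *\<^sub>R h x) > \<bar>z - x\<bar> / real (Suc k)"
          using x by (simp add: E_def del: of_nat_Suc)
        moreover have "min d \<rho> > 0" using \<open>0 < d\<close> \<rho>(1) by simp
        ultimately obtain z where z: "z \<in> {a..b}" "\<bar>z - x\<bar> < min d \<rho>"
            "norm (G z - G x - (z - x) *\<^sub>R h x) > \<bar>z - x\<bar> / real (Suc k)"
          by blast
        \<comment> \<open>The witness \<open>z\<close> may lie on either side of \<open>x\<close>;
          after sorting, the tag is an endpoint of the interval.\<close>
        define u v where "u = min x z" and "v = max x z"
        have "x \<in> {a..b}" using x by (simp add: E_def)
        have "z \<noteq> x" using z(3) by auto
        have sub: "{u..v} \<subseteq> \<gamma> x"
          using z(2) \<rho>(2) by (auto simp: u_def v_def dist_real_def subset_iff min_def max_def split: if_splits)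
        have "norm ((v - u) *\<^sub>R h x - (G v - G u)) = norm (G z - G x - (z - x) *\<^sub>R h x)"
        proof (cases "x \<le> z")
          case True
          then show ?thesis by (simp add: u_def v_def norm_minus_commute)
        next
          case False
          then have "(v - u) *\<^sub>R h x - (G v - G u) = G z - G x - (z - x) *\<^sub>R h x"
            by (simp add: u_def v_def algebra_simps)
          then show ?thesis by simp
        qed
        moreover have "v - u = \<bar>z - x\<bar>" by (simp add: u_def v_def)
        ultimately have "(x, u, v) \<in> I"
          using z(1,3) \<open>x \<in> {a..b}\<close> \<open>z \<noteq> x\<close> sub by (auto simp: I_def u_def v_def)
        moreover have "x \<in> {u..v}" "(v - u) / 2 < d"
          using \<open>v - u = \<bar>z - x\<bar>\<close> z(2) \<open>0 < d\<close> by (auto simp: u_def v_def)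
        ultimately show ?thesis using cball by (intro exI[of _ "(x, u, v)"]) auto
      qed
    qed
    let ?J = "\<lambda>i. cball (?c i) (?r i)"
    have J: "?J (x, u, v) = {u..v}" for x u v using cball by simp
    \<comment> \<open>Henstock's lemma concerns finite families only; a bound common to all finite
      subfamilies carries over to the countable union.\<close>
    have fin: "measure lebesgue (\<Union>i\<in>C'. ?J i) \<le> e" if C': "C' \<subseteq> C" "finite C'" for C'
    proof -
      define tag where "tag = (\<lambda>(x::real, u::real, v::real). (x, {u..v}))"
      have C'I: "C' \<subseteq> I" using C' C by blast
      have dis: "disjnt (snd (tag i)) (snd (tag j))" if ij: "i \<in> C'" "j \<in> C'" "i \<noteq> j" for i j
        using C(3) C'(1) ij unfolding pairwise_def
        by (metis (no_types, lifting) J prod.collapse subsetD tag_def case_prod_conv snd_conv)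
      have inj: "inj_on tag C'"
      proof (rule inj_onI, rule ccontr)
        fix i j assume ij: "i \<in> C'" "j \<in> C'" "tag i = tag j" "i \<noteq> j"
        then have "snd (tag i) = {}" using dis[of i j] by simp
        then show False using C'I ij(1) by (auto simp: tag_def I_def)
      qed
      have part: "tag ` C' tagged_partial_division_of cbox a b"
        unfolding tagged_partial_division_of_def
      proof (intro conjI allI impI; (elim conjE)?)
        show "finite (tag ` C')" using C' by simp
        fix x K assume "(x, K) \<in> tag ` C'"
        then obtain u v where *: "(x, u, v) \<in> I" "K = {u..v}"
          using C'I by (auto simp: tag_def)
        then show "x \<in> K" "K \<subseteq> cbox a b" "\<exists>a b. K = cbox a b"
          by (auto simp: I_def)
      next
        fix x1 K1 x2 K2 assume "(x1, K1) \<in> tag ` C'" "(x2, K2) \<in> tag ` C'" "(x1, K1) \<noteq> (x2, K2)"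
        then have "disjnt K1 K2" using dis by (metis imageE snd_conv)
        then show "interior K1 \<inter> interior K2 = {}"
          unfolding disjnt_def using interior_subset by blast
      qed
      have "\<gamma> fine (tag ` C')"
      proof (rule fineI)
        fix x K assume "(x, K) \<in> tag ` C'"
        then obtain u v where *: "(x, u, v) \<in> I" "K = {u..v}"
          using C'I by (auto simp: tag_def)
        then show "K \<subseteq> \<gamma> x" by (simp add: I_def)
      qed
      note less = \<gamma>[OF part this]
      have "measure lebesgue (\<Union>i\<in>C'. ?J i) \<le> (\<Sum>i\<in>C'. measure lebesgue (?J i))"
        using C' by (intro measure_UNION_le) auto
      also have "\<dots> \<le> (\<Sum>i\<in>C'. real (Suc k) * (case tag i of (x, K) \<Rightarrow> norm (content K *\<^sub>R h x - integral K h)))"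
      proof (rule sum_mono)
        fix i assume "i \<in> C'"
        then obtain x u v where i: "i = (x, u, v)" "(x, u, v) \<in> I" using C'I by (cases i) auto
        then show "measure lebesgue (?J i) \<le> real (Suc k) * (case tag i of (x, K) \<Rightarrow> norm (content K *\<^sub>R h x - integral K h))"
          using G[of u v] by (simp add: I_def tag_def cball field_simps del: of_nat_Suc)
      qed
      also have "\<dots> = real (Suc k) * (\<Sum>(x, K)\<in>tag ` C'. norm (content K *\<^sub>R h x - integral K h))"
        unfolding sum.reindex[OF inj] by (simp add: sum_distrib_left del: of_nat_Suc)
      also have "\<dots> \<le> e" using less by (simp add: field_simps del: of_nat_Suc)
      finally show ?thesis .
    qed
    have meas: "(\<Union>i\<in>C. ?J i) \<in> lmeasurable" "measure lebesgue (\<Union>i\<in>C. ?J i) \<le> e"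
      using fin by (auto intro!: fmeasurable_UN_bound[OF C(1)] measure_UN_bound[OF C(1)])
    show "\<exists>T. E k \<subseteq> T \<and> T \<in> lmeasurable \<and> measure lebesgue T \<le> e"
    proof (intro exI conjI)
      \<comment> \<open>Vitali covers \<open>E k\<close> only up to a null set, which is adjoined
        here at no cost in measure.\<close>
      let ?T = "(\<Union>i\<in>C. ?J i) \<union> (E k - (\<Union>i\<in>C. ?J i))"
      show "E k \<subseteq> ?T" by blast
      show "?T \<in> lmeasurable"
        by (rule fmeasurable.Un[OF meas(1) negligible_imp_measurable[OF C(4)]])
      have "measure lebesgue ?T = measure lebesgue (\<Union>i\<in>C. ?J i)"
        using C(4) meas(1) by (intro measure_Un_null_set) (auto simp: negligible_iff_null_sets fmeasurableD)
      then show "measure lebesgue ?T \<le> e" using meas(2) by simp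
    qed
  qed
  then have "negligible (\<Union>k. E k)" by (simp add: negligible_Union_nat)
  then show thesis
  proof (rule that)
    fix x assume x: "x \<in> {a..b} - (\<Union>k. E k)"
    show "((\<lambda>s. integral {a..s} h) has_vector_derivative h x) (at x within {a..b})"
      unfolding has_vector_derivative_def has_derivative_within_alt G_def[symmetric]
    proof (intro conjI allI impI bounded_linear_scaleR_left)
      fix e :: real assume "e > 0"
      then obtain k where k: "inverse (real (Suc k)) < e" using reals_Archimedean by blast
      have "x \<notin> E k" "x \<in> {a..b}" using x by auto
      then obtain d where "d > 0" and d: "\<And>z. z \<in> {a..b} \<Longrightarrow>
          \<not> (\<bar>z - x\<bar> < d \<and> norm (G z - G x - (z - x) *\<^sub>R h x) > \<bar>z - x\<bar> / real (Suc k))"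
        unfolding E_def by blast
      have "norm (G z - G x - (z - x) *\<^sub>R h x) \<le> e * norm (z - x)"
        if "z \<in> {a..b}" "norm (z - x) < d" for z
      proof -
        have "norm (G z - G x - (z - x) *\<^sub>R h x) \<le> inverse (real (Suc k)) * \<bar>z - x\<bar>"
          using d[of z] that by (simp add: field_simps not_less del: of_nat_Suc)
        also have "\<dots> \<le> e * \<bar>z - x\<bar>" using k by (intro mult_right_mono) auto
        finally show ?thesis by simp
      qed
      then show "\<exists>d>0. \<forall>z\<in>{a..b}. norm (z - x) < d \<longrightarrow> norm (G z - G x - (z - x) *\<^sub>R h x) \<le> e * norm (z - x)"
        using \<open>d > 0\<close> by blast
    qed
  qed
qed

section \<open>Elementary properties of absolutely continuous curves\<close>

lemma absolutely_continuous_curve_subset: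
  assumes "absolutely_continuous_curve S y" "S' \<subseteq> S"
  shows "absolutely_continuous_curve S' y"
proof (rule absolutely_continuous_curveI)
  fix e :: real assume "e > 0"
  then obtain \<delta> where "\<delta> > 0" and \<delta>: "\<And>P. finite P \<Longrightarrow> (\<And>a b. (a, b) \<in> P \<Longrightarrow> a \<le> b \<and> {a..b} \<subseteq> S) \<Longrightarrow>
       disjoint_family_on (\<lambda>(a, b). {a<..<b}) P \<Longrightarrow> (\<Sum>(a, b)\<in>P. b - a) < \<delta> \<Longrightarrow>
       (\<Sum>(a, b)\<in>P. norm (y b - y a)) < e"
    using absolutely_continuous_curveE[OF assms(1)] by blast
  show "\<exists>\<delta>>0. \<forall>P. finite P \<longrightarrow> (\<forall>a b. (a, b) \<in> P \<longrightarrow> a \<le> b \<and> {a..b} \<subseteq> S') \<longrightarrow>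
       disjoint_family_on (\<lambda>(a, b). {a<..<b}) P \<longrightarrow> (\<Sum>(a, b)\<in>P. b - a) < \<delta> \<longrightarrow>
       (\<Sum>(a, b)\<in>P. norm (y b - y a)) < e"
    by (intro exI[of _ \<delta>] conjI allI impI \<open>\<delta> > 0\<close> \<delta>) (use assms(2) in auto)
qed

lemma absolutely_continuous_curve_imp_continuous_on:
  assumes y: "absolutely_continuous_curve {a..b} y"
  shows "continuous_on {a..b} y"
  unfolding continuous_on_iff
proof (intro ballI allI impI)
  fix x e :: real assume x: "x \<in> {a..b}" and "e > 0"
  then obtain \<delta> where "\<delta> > 0" and \<delta>: "\<And>P. finite P \<Longrightarrow> (\<And>u v. (u, v) \<in> P \<Longrightarrow> u \<le> v \<and> {u..v} \<subseteq> {a..b}) \<Longrightarrow>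
       disjoint_family_on (\<lambda>(u, v). {u<..<v}) P \<Longrightarrow> (\<Sum>(u, v)\<in>P. v - u) < \<delta> \<Longrightarrow>
       (\<Sum>(u, v)\<in>P. norm (y v - y u)) < e"
    using absolutely_continuous_curveE[OF y] by blast
  have "dist (y z) (y x) < e" if z: "z \<in> {a..b}" "dist z x < \<delta>" for z
  proof -
    have "max x z - min x z < \<delta>" "{min x z..max x z} \<subseteq> {a..b}"
      using x z by (auto simp: dist_real_def)
    then have "(\<Sum>(u, v)\<in>{(min x z, max x z)}. norm (y v - y u)) < e"
      by (intro \<delta>) (simp_all add: disjoint_family_on_def)
    then have "norm (y (max x z) - y (min x z)) < e" by simp
    then show ?thesis
      by (auto simp: dist_norm min_def max_def norm_minus_commute split: if_splits)
  qed
  then show "\<exists>d>0. \<forall>z\<in>{a..b}. dist z x < d \<longrightarrow> dist (y z) (y x) < e"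
    using \<open>\<delta> > 0\<close> by blast
qed

lemma lipschitz_on_imp_absolutely_continuous_curve:
  assumes "B-lipschitz_on S y"
  shows "absolutely_continuous_curve S y"
proof (rule absolutely_continuous_curveI)
  fix e :: real assume "e > 0"
  have B: "B \<ge> 0" using assms by (rule lipschitz_on_nonneg)
  \<comment> \<open>\<open>B + 1\<close> in place of \<open>B\<close> keeps the divisor positive
    when \<open>B = 0\<close>.\<close>
  have "(\<Sum>(a, b)\<in>P. norm (y b - y a)) < e"
    if P: "\<forall>a b. (a, b) \<in> P \<longrightarrow> a \<le> b \<and> {a..b} \<subseteq> S" "(\<Sum>(a, b)\<in>P. b - a) < e / (B + 1)" for P
  proof -
    have "(\<Sum>(a, b)\<in>P. norm (y b - y a)) \<le> (\<Sum>(a, b)\<in>P. (B + 1) * (b - a))"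
    proof (rule sum_mono, clarify)
      fix a b assume "(a, b) \<in> P"
      then have ab: "a \<le> b" "a \<in> S" "b \<in> S" using P(1)[rule_format, of a b] by auto
      then have "norm (y b - y a) \<le> B * (b - a)"
        using lipschitz_onD[OF assms ab(3,2)] by (simp add: dist_norm)
      also have "\<dots> \<le> (B + 1) * (b - a)" using ab by (intro mult_right_mono) auto
      finally show "norm (y b - y a) \<le> (B + 1) * (b - a)" .
    qed
    also have "\<dots> = (B + 1) * (\<Sum>(a, b)\<in>P. b - a)"
      by (simp add: sum_distrib_left case_prod_unfold)
    also have "\<dots> < e" using P(2) B by (simp add: field_simps)
    finally show ?thesis .
  qed
  moreover have "0 < e / (B + 1)" using B \<open>e > 0\<close> by simp
  ultimately show "\<exists>\<delta>>0. \<forall>P. finite P \<longrightarrow> (\<forall>a b. (a, b) \<in> P \<longrightarrow> a \<le> b \<and> {a..b} \<subseteq> S) \<longrightarrow>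
       disjoint_family_on (\<lambda>(a, b). {a<..<b}) P \<longrightarrow> (\<Sum>(a, b)\<in>P. b - a) < \<delta> \<longrightarrow>
       (\<Sum>(a, b)\<in>P. norm (y b - y a)) < e"
    by (intro exI[of _ "e / (B + 1)"] conjI allI impI)
qed

section \<open>Controlled Lipschitz systems\<close>

lemma norm_integral_le_interval:
  fixes f :: "real \<Rightarrow> 'a::euclidean_space"
  assumes "f integrable_on {a..b}" "a \<le> b" "\<And>x. x \<in> {a..b} \<Longrightarrow> norm (f x) \<le> B"
  shows "norm (integral {a..b} f) \<le> B * (b - a)"
proof -
  have "norm (integral {a..b} f) \<le> integral {a..b} (\<lambda>_. B)"
    by (rule integral_norm_bound_integral[OF assms(1) integrable_const_ivl assms(3)])
  then show ?thesis using assms(2) by (simp add: mult.commute)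
qed

text \<open>Integrating factor: multiplied by \<open>exp (- L * (r - t))\<close>, the right-hand
  side \<open>W\<close> of the hypothesis has a nonpositive derivative, since \<open>w\<close> stays
  below \<open>W\<close>. The product therefore never exceeds its initial value
  \<open>a\<close>.\<close>

lemma gronwall:
  fixes w :: "real \<Rightarrow> real"
  assumes w: "continuous_on {t..T} w" and "L \<ge> 0"
    and le: "\<And>s. s \<in> {t..T} \<Longrightarrow> w s \<le> a + L * integral {t..s} w"
    and s: "s \<in> {t..T}"
  shows "w s \<le> a * exp (L * (s - t))"
proof -
  define W where "W = (\<lambda>r. a + L * integral {t..r} w)"
  define v where "v = (\<lambda>r. exp (- L * (r - t)) * W r)"
  have dW: "(W has_real_derivative L * w r) (at r within {t..T})" if "r \<in> {t..T}" for r
    unfolding W_def using integral_has_real_derivative[OF w that]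
    by (auto intro!: derivative_eq_intros)
  have dv: "(v has_real_derivative exp (- L * (r - t)) * L * (w r - W r)) (at r within {t..T})"
    if "r \<in> {t..T}" for r
    unfolding v_def using dW[OF that] by (auto intro!: derivative_eq_intros simp: algebra_simps)
  have "v s \<le> v t"
  proof (rule DERIV_nonpos_imp_decreasing_open[where f = v])
    show "t \<le> s" using s by simp
    show "\<exists>y. (v has_real_derivative y) (at r) \<and> y \<le> 0" if r: "t < r" "r < s" for r
    proof (intro exI conjI)
      have "r \<in> {t..T}" "r \<in> {t<..<T}" using r s by auto
      then show "(v has_real_derivative exp (- L * (r - t)) * L * (w r - W r)) (at r)"
        using dv[of r] by (simp add: at_within_Icc_at)
      show "exp (- L * (r - t)) * L * (w r - W r) \<le> 0"
        using le[OF \<open>r \<in> {t..T}\<close>] \<open>L \<ge> 0\<close> by (intro mult_nonneg_nonpos) (auto simp: W_def)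
    qed
    have "continuous_on {t..T} v" 
      by (rule DERIV_continuous_on[where D = "\<lambda>r. exp (- L * (r - t)) * L * (w r - W r)"]) (rule dv)
    then show "continuous_on {t..s} v" using s by (auto elim: continuous_on_subset)
  qed
  also have "v t = a" by (simp add: v_def W_def)
  finally have decay: "exp (- L * (s - t)) * W s * exp (L * (s - t)) \<le> a * exp (L * (s - t))"
    by (intro mult_right_mono) (auto simp: v_def)
  have cancel: "exp (- L * (s - t)) * W s * exp (L * (s - t)) = W s"
    by (simp add: mult.commute mult.left_commute flip: exp_add)
  have "w s \<le> W s" using le[OF s] by (simp add: W_def)
  also have "\<dots> \<le> a * exp (L * (s - t))" using decay unfolding cancel .
  finally show ?thesis .
qed

text \<open>The initial time is a parameter, so a single interpretation serves all controls and
  initial states from that time. Compactness of \<open>D\<close> is the source of every bound that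
  is uniform in the control.\<close>

locale lipschitz_control_system =
  fixes F :: "'a::euclidean_space \<Rightarrow> 'd::euclidean_space \<Rightarrow> 'a" and D :: "'d set" and L T t :: real
  assumes D_nonempty: "D \<noteq> {}" and D_compact: "compact D"
    and F_continuous: "continuous_on (UNIV \<times> D) (\<lambda>(x, d). F x d)"
    and F_lipschitz: "\<And>d. d \<in> D \<Longrightarrow> L-lipschitz_on UNIV (\<lambda>x. F x d)"
    and t_le: "t \<le> T"
begin

section \<open>Boundedness and integrability of the field along a curve\<close>

lemma L_nonneg: "L \<ge> 0"
  using D_nonempty F_lipschitz lipschitz_on_nonneg by blast

lemma norm_F_diff_le: "d \<in> D \<Longrightarrow> norm (F x d - F z d) \<le> L * norm (x - z)"
  using lipschitz_onD[OF F_lipschitz, of d x z] by (simp add: dist_norm)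

lemma controls_in: "d \<in> controls D T t \<Longrightarrow> s \<in> {t..T} \<Longrightarrow> d s \<in> D"
  by (auto simp: controls_def)

text \<open>The pairs of state and control value stay in the compact product of the image of
  \<open>y\<close> with \<open>D\<close>.\<close>

lemma field_along_bounded:
  assumes d: "d \<in> controls D T t" and y: "continuous_on {t..T} y"
  obtains B where "B \<ge> 0" "\<And>s. s \<in> {t..T} \<Longrightarrow> norm (F (y s) (d s)) \<le> B"
proof -
  have "compact (y ` {t..T} \<times> D)"
    using y D_compact by (intro compact_Times compact_continuous_image) auto
  then have "compact ((\<lambda>(x, d). F x d) ` (y ` {t..T} \<times> D))"
    by (rule compact_continuous_image[OF continuous_on_subset[OF F_continuous], rotated]) auto
  then obtain B where B: "B > 0" "\<And>z. z \<in> (\<lambda>(x, d). F x d) ` (y ` {t..T} \<times> D) \<Longrightarrow> norm z \<le> B"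
    by (meson bounded_pos compact_imp_bounded)
  show thesis
  proof (rule that[of B])
    fix s assume s: "s \<in> {t..T}"
    then have "(y s, d s) \<in> y ` {t..T} \<times> D" using controls_in[OF d] by auto
    then show "norm (F (y s) (d s)) \<le> B" by (intro B(2)) force
  qed (use B in simp)
qed

lemma field_along_integrable:
  assumes d: "d \<in> controls D T t" and y: "continuous_on {t..T} y"
  shows "(\<lambda>s. F (y s) (d s)) integrable_on {t..T}"
proof -
  have "y \<in> borel_measurable (lebesgue_on {t..T})"
    using y by (simp add: continuous_imp_measurable_on_sets_lebesgue)
  moreover have "d \<in> borel_measurable (lebesgue_on {t..T})"
    using d by (simp add: controls_def)
  ultimately have "(\<lambda>s. (y s, d s)) \<in> borel_measurable (lebesgue_on {t..T})"
    by (rule borel_measurable_Pair)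
  \<comment> \<open>\<open>F\<close> is continuous only on \<open>UNIV \<times> D\<close>, so the
    composition has to be measured through the restricted Borel space.\<close>
  then have "(\<lambda>s. (y s, d s)) \<in> lebesgue_on {t..T} \<rightarrow>\<^sub>M restrict_space borel (UNIV \<times> D)"
    using controls_in[OF d] by (intro measurable_restrict_space2) auto
  from measurable_compose[OF this borel_measurable_continuous_on_restrict[OF F_continuous]]
  have meas: "(\<lambda>s. F (y s) (d s)) \<in> borel_measurable (lebesgue_on {t..T})" by simp
  obtain B where "\<And>s. s \<in> {t..T} \<Longrightarrow> norm (F (y s) (d s)) \<le> B"
    using field_along_bounded[OF d y] by metis
  then show ?thesis
    by (rule measurable_bounded_by_integrable_imp_integrable[OF meas integrable_const_ivl]) simp_all
qed

section \<open>Solutions and the integral equation\<close>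

lemma is_solution_imp_integral:
  assumes d: "d \<in> controls D T t" and y: "is_solution F T x t d y"
  shows "continuous_on {t..T} y"
    and "\<And>s. s \<in> {t..T} \<Longrightarrow> y s = x + integral {t..s} (\<lambda>r. F (y r) (d r))"
proof -
  have ac: "absolutely_continuous_curve {t..T} y" and x: "y t = x"
    and ae: "AE s in lebesgue_on {t..T}. (y has_vector_derivative F (y s) (d s)) (at s within {t..T})"
    using y by (auto simp: is_solution_def)
  show "continuous_on {t..T} y"
    using ac by (rule absolutely_continuous_curve_imp_continuous_on)
  have "AE s in lebesgue. s \<in> {t..T} \<longrightarrow> (y has_vector_derivative F (y s) (d s)) (at s within {t..T})"
    using ae by (simp add: AE_restrict_space_iff)
  then obtain N where N: "N \<in> null_sets lebesgue"
    "{s. \<not> (s \<in> {t..T} \<longrightarrow> (y has_vector_derivative F (y s) (d s)) (at s within {t..T}))} \<subseteq> N"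
    unfolding eventually_ae_filter by auto
  fix s assume s: "s \<in> {t..T}"
  have "((\<lambda>r. F (y r) (d r)) has_integral (y s - y t)) {t..s}"
  proof (rule fundamental_theorem_of_calculus_absolutely_continuous)
    show "absolutely_continuous_curve {t..s} y"
      using ac s by (elim absolutely_continuous_curve_subset) auto
    show "negligible N" using N by (simp add: negligible_iff_null_sets)
    show "(y has_vector_derivative F (y r) (d r)) (at r within {t..s})" if "r \<in> {t..s} - N" for r
    proof (rule has_vector_derivative_within_subset)
      show "(y has_vector_derivative F (y r) (d r)) (at r within {t..T})" using that s N(2) by auto
    qed (use s in auto)
  qed (use s in auto)
  then show "y s = x + integral {t..s} (\<lambda>r. F (y r) (d r))"
    using x by (simp add: integral_unique)
qed

text \<open>A bounded field makes \<open>y\<close> Lipschitz and hence absolutely continuous;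
  Lebesgue differentiation of the integral returns the differential equation almost
  everywhere.\<close>

lemma integral_imp_is_solution:
  assumes d: "d \<in> controls D T t" and y: "continuous_on {t..T} y"
    and eq: "\<And>s. s \<in> {t..T} \<Longrightarrow> y s = x + integral {t..s} (\<lambda>r. F (y r) (d r))"
  shows "is_solution F T x t d y"
proof -
  let ?h = "\<lambda>r. F (y r) (d r)"
  have int: "?h integrable_on {t..T}" using field_along_integrable[OF d y] .
  obtain B where B: "B \<ge> 0" "\<And>s. s \<in> {t..T} \<Longrightarrow> norm (?h s) \<le> B"
    using field_along_bounded[OF d y] by metis
  have step: "norm (y v - y u) \<le> B * (v - u)" if uv: "t \<le> u" "u \<le> v" "v \<le> T" for u v
  proof -
    have "y v - y u = integral {u..v} ?h"
      using Henstock_Kurzweil_Integration.integral_combine[of t u v ?h] uv eq[of u] eq[of v]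
        integrable_subinterval_real[OF int, of t v] by (simp add: algebra_simps)
    also have "norm \<dots> \<le> B * (v - u)"
      using uv B integrable_subinterval_real[OF int, of u v]
      by (intro norm_integral_le_interval) auto
    finally show ?thesis .
  qed
  have "B-lipschitz_on {t..T} y"
  proof (rule lipschitz_onI)
    fix u v assume "u \<in> {t..T}" "v \<in> {t..T}"
    then show "dist (y u) (y v) \<le> B * dist u v"
      using step[of u v] step[of v u] by (cases "u \<le> v") (auto simp: dist_norm norm_minus_commute)
  qed (use B in simp)
  then have ac: "absolutely_continuous_curve {t..T} y"
    by (rule lipschitz_on_imp_absolutely_continuous_curve)
  obtain N where N: "negligible N"
    "\<And>s. s \<in> {t..T} - N \<Longrightarrow> ((\<lambda>s. integral {t..s} ?h) has_vector_derivative ?h s) (at s within {t..T})"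
    using indefinite_integral_has_vector_derivative_ae[OF int] by blast
  have der: "(y has_vector_derivative ?h s) (at s within {t..T})" if s: "s \<in> {t..T} - N" for s
  proof (rule has_vector_derivative_transform)
    show "((\<lambda>s. x + integral {t..s} ?h) has_vector_derivative ?h s) (at s within {t..T})"
      using N(2)[OF s] by (auto intro!: derivative_eq_intros)
  qed (use s eq in auto)
  have "AE s in lebesgue. s \<notin> N" using N(1) by (simp add: negligible_iff_null_sets AE_not_in)
  then have "AE s in lebesgue. s \<in> {t..T} \<longrightarrow> (y has_vector_derivative ?h s) (at s within {t..T})"
    by eventually_elim (use der in auto)
  then have "AE s in lebesgue_on {t..T}. (y has_vector_derivative ?h s) (at s within {t..T})"
    by (simp add: AE_restrict_space_iff)
  moreover have "y t = x" using eq[of t] t_le by simp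
  ultimately show ?thesis using ac by (simp add: is_solution_def)
qed

text \<open>Shared by three arguments, which is why the majorant \<open>m\<close> is left free: the
  distance itself for uniqueness, the norm for the growth bound (with \<open>z = 0\<close>), an
  exponential weight for the contraction.\<close>

lemma norm_integral_field_diff_le:
  assumes d: "d \<in> controls D T t" and y: "continuous_on {t..T} y" "continuous_on {t..T} z"
    and m: "continuous_on {t..T} m" "\<And>r. r \<in> {t..T} \<Longrightarrow> norm (y r - z r) \<le> m r" and s: "s \<in> {t..T}"
  shows "norm (integral {t..s} (\<lambda>r. F (y r) (d r)) - integral {t..s} (\<lambda>r. F (z r) (d r)))
    \<le> L * integral {t..s} m"
proof -
  have sub: "{t..s} \<subseteq> {t..T}" using s by auto
  have int: "(\<lambda>r. F (y r) (d r)) integrable_on {t..s}" "(\<lambda>r. F (z r) (d r)) integrable_on {t..s}"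
    using y by (auto intro!: integrable_subinterval_real[OF field_along_integrable[OF d] sub])
  have m_int: "(\<lambda>r. L * m r) integrable_on {t..s}"
    by (intro integrable_continuous_real continuous_intros continuous_on_subset[OF m(1) sub])
  have "norm (integral {t..s} (\<lambda>r. F (y r) (d r) - F (z r) (d r))) \<le> integral {t..s} (\<lambda>r. L * m r)"
  proof (rule integral_norm_bound_integral[OF integrable_diff[OF int] m_int])
    fix r assume r: "r \<in> {t..s}"
    then have "norm (F (y r) (d r) - F (z r) (d r)) \<le> L * norm (y r - z r)"
      using sub controls_in[OF d] by (intro norm_F_diff_le) auto
    also have "\<dots> \<le> L * m r" using r sub m(2) L_nonneg by (intro mult_left_mono) auto
    finally show "norm (F (y r) (d r) - F (z r) (d r)) \<le> L * m r" .
  qed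
  then show ?thesis using int by (simp add: integral_diff)
qed

lemma integral_equation_unique:
  assumes d: "d \<in> controls D T t" and y: "continuous_on {t..T} y" and z: "continuous_on {t..T} z"
    and y_eq: "\<And>s. s \<in> {t..T} \<Longrightarrow> y s = x + integral {t..s} (\<lambda>r. F (y r) (d r))"
    and z_eq: "\<And>s. s \<in> {t..T} \<Longrightarrow> z s = x + integral {t..s} (\<lambda>r. F (z r) (d r))"
    and s: "s \<in> {t..T}"
  shows "y s = z s"
proof -
  have cont: "continuous_on {t..T} (\<lambda>r. norm (y r - z r))"
    by (intro continuous_intros y z)
  have "norm (y s - z s) \<le> 0 * exp (L * (s - t))"
  proof (rule gronwall[OF cont L_nonneg _ s])
    fix r assume r: "r \<in> {t..T}"
    show "norm (y r - z r) \<le> 0 + L * integral {t..r} (\<lambda>r. norm (y r - z r))"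
      using norm_integral_field_diff_le[OF d y z cont _ r] y_eq[OF r] z_eq[OF r] by simp
  qed
  then show ?thesis by simp
qed

text \<open>Comparison with the zero curve, along which the field is at most \<open>B\<close> for
  every control, followed by Gronwall. The resulting bound does not mention
  \<open>d\<close>.\<close>

lemma integral_equation_bound:
  assumes d: "d \<in> controls D T t" and y: "continuous_on {t..T} y"
    and y_eq: "\<And>s. s \<in> {t..T} \<Longrightarrow> y s = x + integral {t..s} (\<lambda>r. F (y r) (d r))"
    and B: "\<And>d. d \<in> D \<Longrightarrow> norm (F 0 d) \<le> B" and s: "s \<in> {t..T}"
  shows "norm (y s) \<le> (norm x + B * (T - t)) * exp (L * (T - t))"
proof -
  have "B \<ge> 0" using B D_nonempty norm_ge_zero order_trans by blast
  have cont: "continuous_on {t..T} (\<lambda>r. norm (y r))" and cont0: "continuous_on {t..T} (\<lambda>_. 0 :: 'a)"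
    by (intro continuous_intros y)+
  have "norm (y s) \<le> (norm x + B * (T - t)) * exp (L * (s - t))"
  proof (rule gronwall[OF cont L_nonneg _ s])
    fix r assume r: "r \<in> {t..T}"
    have "norm (integral {t..r} (\<lambda>r. F 0 (d r))) \<le> B * (r - t)"
      using r B controls_in[OF d] \<open>B \<ge> 0\<close>
        integrable_subinterval_real[OF field_along_integrable[OF d cont0], of t r]
      by (intro norm_integral_le_interval) auto
    also have "\<dots> \<le> B * (T - t)" using r \<open>B \<ge> 0\<close> by (intro mult_left_mono) auto
    finally have F0: "norm (integral {t..r} (\<lambda>r. F 0 (d r))) \<le> B * (T - t)" .
    have "norm (integral {t..r} (\<lambda>r. F (y r) (d r)) - integral {t..r} (\<lambda>r. F 0 (d r)))
        \<le> L * integral {t..r} (\<lambda>r. norm (y r))"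
      by (rule norm_integral_field_diff_le[OF d y cont0 cont _ r]) simp
    with F0 have "norm (integral {t..r} (\<lambda>r. F (y r) (d r))) \<le> B * (T - t) + L * integral {t..r} (\<lambda>r. norm (y r))"
      using norm_triangle_sub[of "integral {t..r} (\<lambda>r. F (y r) (d r))" "integral {t..r} (\<lambda>r. F 0 (d r))"]
      by linarith
    then show "norm (y r) \<le> (norm x + B * (T - t)) + L * integral {t..r} (\<lambda>r. norm (y r))"
      using y_eq[OF r] norm_triangle_ineq[of x "integral {t..r} (\<lambda>r. F (y r) (d r))"] by simp
  qed
  also have "\<dots> \<le> (norm x + B * (T - t)) * exp (L * (T - t))"
    using s \<open>B \<ge> 0\<close> L_nonneg t_le by (intro mult_left_mono) (auto intro!: mult_left_mono add_nonneg_nonneg)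
  finally show ?thesis .
qed

text \<open>Picard iteration contracts globally on \<open>[t,T]\<close> once curves are rescaled by
  \<open>exp (- K * (s - t))\<close> with \<open>K > 2 * L\<close>.\<close>

lemma integral_equation_solvable:
  assumes d: "d \<in> controls D T t"
  obtains y where "continuous_on {t..T} y"
    "\<And>s. s \<in> {t..T} \<Longrightarrow> y s = x + integral {t..s} (\<lambda>r. F (y r) (d r))"
proof -
  \<comment> \<open>Positive even for \<open>L = 0\<close>; the contraction factor will be
    \<open>L / K\<close>.\<close>
  define K where "K = 2 * L + 1"
  have K: "K > 0" "L / K \<le> 1 / 2" using L_nonneg by (auto simp: K_def field_simps)
  \<comment> \<open>\<open>z\<close> is the rescaled curve and \<open>lft z\<close> the actual one;
    \<open>q\<close> below is the Picard operator written in rescaled form.\<close>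
  define lft where "lft = (\<lambda>(z :: real \<Rightarrow>\<^sub>C 'a) r. exp (K * (r - t)) *\<^sub>R z r)"
  have lft: "continuous_on {t..T} (lft z)" for z
    unfolding lft_def by (intro continuous_intros continuous_on_apply_bcontfun)
  define q where "q = (\<lambda>z s. exp (- K * (s - t)) *\<^sub>R (x + integral {t..s} (\<lambda>r. F (lft z r) (d r))))"
  have q: "continuous_on (cbox t T) (q z)" for z
    unfolding q_def cbox_interval
    by (intro continuous_intros indefinite_integral_continuous_1 field_along_integrable[OF d] lft)
  \<comment> \<open>The complete space consists of bounded continuous functions on the whole line.
    Extending by \<open>clamp\<close> adds no new values, so estimates on \<open>[t,T]\<close>
    control the sup distance.\<close>
  have "\<exists>Qz. (\<forall>s\<in>{t..T}. apply_bcontfun Qz s = q z s) \<and> (\<forall>s. apply_bcontfun Qz s = q z (clamp t T s))" for z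
    using continuous_on_cbox_bcontfunE[OF q] by (metis cbox_interval)
  then obtain Q where Q: "\<And>z s. s \<in> {t..T} \<Longrightarrow> apply_bcontfun (Q z) s = q z s"
      "\<And>z s. apply_bcontfun (Q z) s = q z (clamp t T s)"
    by metis
  have contr: "dist (q z s) (q w s) \<le> 1 / 2 * dist z w" if s: "s \<in> {t..T}" for z w s
  proof -
    define m where "m = (\<lambda>r. exp (K * (r - t)) * dist z w)"
    have m: "continuous_on {t..T} m" unfolding m_def by (intro continuous_intros)
    have le: "norm (lft z r - lft w r) \<le> m r" for r
      using dist_bounded[of z r w]
      by (simp add: lft_def m_def dist_norm flip: scaleR_diff_right)
    \<comment> \<open>Integrating the weight gains a factor \<open>1 / K\<close>, while the leading
      \<open>exp (- K * (s - t))\<close> of \<open>q\<close> cancels its growth.\<close>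
    have "(m has_integral (exp (K * (s - t)) * dist z w / K - exp (K * (t - t)) * dist z w / K)) {t..s}"
      unfolding m_def using s K(1)
      by (intro fundamental_theorem_of_calculus)
        (auto intro!: derivative_eq_intros simp flip: has_real_derivative_iff_has_vector_derivative)
    then have "integral {t..s} m = (exp (K * (s - t)) - 1) * dist z w / K"
      by (simp add: integral_unique algebra_simps diff_divide_distrib)
    also have "\<dots> \<le> exp (K * (s - t)) * dist z w / K"
      using K(1) by (intro divide_right_mono mult_right_mono) auto
    finally have int_m: "integral {t..s} m \<le> exp (K * (s - t)) * dist z w / K" .
    have "dist (q z s) (q w s) = exp (- K * (s - t)) *
        norm (integral {t..s} (\<lambda>r. F (lft z r) (d r)) - integral {t..s} (\<lambda>r. F (lft w r) (d r)))"
      by (simp add: q_def dist_norm flip: scaleR_diff_right)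
    also have "\<dots> \<le> exp (- K * (s - t)) * (L * (exp (K * (s - t)) * dist z w / K))"
      using norm_integral_field_diff_le[OF d lft lft m le s] mult_left_mono[OF int_m L_nonneg]
      by (intro mult_left_mono) auto
    also have "\<dots> = (exp (- K * (s - t)) * exp (K * (s - t))) * (L / K) * dist z w" by simp
    also have "\<dots> = L / K * dist z w" by (simp flip: exp_add)
    also have "\<dots> \<le> 1 / 2 * dist z w" by (intro mult_right_mono K) simp
    finally show ?thesis .
  qed
  have "clamp t T s \<in> {t..T}" for s
    using clamp_in_interval[of t T s] t_le by (simp add: cbox_interval)
  then have "dist (Q z) (Q w) \<le> 1 / 2 * dist z w" for z w
    by (intro dist_bound) (simp only: Q(2) contr)
  then obtain z where z: "Q z = z"
    using banach_fix_type[of "1 / 2" Q] by auto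
  show thesis
  proof (rule that[OF lft])
    fix s assume s: "s \<in> {t..T}"
    have "lft z s = exp (K * (s - t)) *\<^sub>R q z s"
      using Q(1)[OF s, of z] z by (simp add: lft_def)
    also have "\<dots> = (exp (K * (s - t)) * exp (- K * (s - t))) *\<^sub>R (x + integral {t..s} (\<lambda>r. F (lft z r) (d r)))"
      by (simp add: q_def)
    also have "exp (K * (s - t)) * exp (- K * (s - t)) = 1" by (simp flip: exp_add)
    finally show "lft z s = x + integral {t..s} (\<lambda>r. F (lft z r) (d r))" by simp
  qed
qed

section \<open>Well-posedness of the auxiliary system\<close>

lemma is_solution_unique:
  assumes d: "d \<in> controls D T t" and "is_solution F T x t d y" "is_solution F T x t d z" "s \<in> {t..T}"
  shows "y s = z s"
  using integral_equation_unique[OF d is_solution_imp_integral(1)[OF d assms(2)]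
      is_solution_imp_integral(1)[OF d assms(3)] is_solution_imp_integral(2)[OF d assms(2)]
      is_solution_imp_integral(2)[OF d assms(3)] assms(4)] .

lemma is_solution_solution:
  assumes d: "d \<in> controls D T t"
  shows "is_solution F T x t d (solution F T x t d)"
proof -
  obtain y where y: "continuous_on {t..T} y"
    "\<And>s. s \<in> {t..T} \<Longrightarrow> y s = x + integral {t..s} (\<lambda>r. F (y r) (d r))"
    using integral_equation_solvable[OF d] by blast
  \<comment> \<open>Uniqueness determines values on \<open>[t,T]\<close> only; restricting fixes the
    rest, so that the definite description has a unique referent.\<close>
  define z where "z = restrict y {t..T}"
  have z: "z \<in> extensional {t..T}" "is_solution F T x t d z"
  proof -
    have eq: "y s = z s" if "s \<in> {t..T}" for s using that by (simp add: z_def)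
    show "is_solution F T x t d z"
    proof (rule integral_imp_is_solution[OF d])
      show "continuous_on {t..T} z" using continuous_on_eq[OF y(1) eq] .
      fix s assume s: "s \<in> {t..T}"
      have "integral {t..s} (\<lambda>r. F (y r) (d r)) = integral {t..s} (\<lambda>r. F (z r) (d r))"
        using s by (intro integral_cong) (simp add: eq)
      then show "z s = x + integral {t..s} (\<lambda>r. F (z r) (d r))"
        using y(2)[OF s] eq[OF s] by simp
    qed
  qed (simp add: z_def)
  have "solution F T x t d = z"
    unfolding solution_def
  proof (rule the_equality)
    fix w assume w: "w \<in> extensional {t..T} \<and> is_solution F T x t d w"
    show "w = z"
      by (rule extensionalityI[of _ "{t..T}"]) (use w z is_solution_unique[OF d] in auto)
  qed (use z in simp)
  with z show ?thesis by simp
qed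

lemma solution_bounded:
  obtains B where "\<And>d s. d \<in> controls D T t \<Longrightarrow> s \<in> {t..T} \<Longrightarrow> norm (solution F T x t d s) \<le> B"
proof -
  have "continuous_on D (\<lambda>d. F 0 d)"
  proof -
    have "continuous_on D ((\<lambda>(x, d). F x d) \<circ> Pair 0)"
      by (intro continuous_on_compose continuous_intros continuous_on_subset[OF F_continuous]) auto
    then show ?thesis by (simp add: o_def)
  qed
  then have "bounded (F 0 ` D)"
    using D_compact by (intro compact_imp_bounded compact_continuous_image)
  then obtain B where B: "\<And>d. d \<in> D \<Longrightarrow> norm (F 0 d) \<le> B" by (auto simp: bounded_iff)
  show thesis
  proof (rule that)
    fix d s assume d: "d \<in> controls D T t" and s: "s \<in> {t..T}"
    note sol = is_solution_solution[OF d, of x]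
    show "norm (solution F T x t d s) \<le> (norm x + B * (T - t)) * exp (L * (T - t))"
      by (rule integral_equation_bound[OF d is_solution_imp_integral(1)[OF d sol]
            is_solution_imp_integral(2)[OF d sol] B s])
  qed
qed

section \<open>The sign of the value function and viability\<close>

lemma controls_nonempty: "controls D T t \<noteq> {}"
proof -
  obtain d where "d \<in> D" using D_nonempty by blast
  then have "(\<lambda>_. d) \<in> controls D T t" by (simp add: controls_def)
  then show ?thesis by blast
qed

text \<open>All trajectories from \<open>x\<close> stay in one ball, on which the continuous
  constraints are bounded above. Both suprema are thus taken over nonempty families bounded above,
  and a supremum is at most 0 iff every member is.\<close>

lemma value_function_le_0_iff:
  fixes g :: "nat \<Rightarrow> 'a \<Rightarrow> real \<Rightarrow> real" and l :: "nat \<Rightarrow> 'a \<Rightarrow> real"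
  assumes "nX \<ge> 1" "nTR \<ge> 1"
    and g: "\<And>i. i \<in> {1..nX} \<Longrightarrow> continuous_on UNIV (\<lambda>(x, s). g i x s)"
    and l: "\<And>i. i \<in> {1..nTR} \<Longrightarrow> continuous_on UNIV (l i)"
  shows "value_function F D T nX g nTR l x t \<le> 0 \<longleftrightarrow>
    (\<forall>d\<in>controls D T t. (\<forall>s\<in>{t..T}. solution F T x t d s \<in> constraint_set nX g s) \<and>
       solution F T x t d T \<in> target_set nTR l)"
proof -
  let ?\<phi> = "solution F T x t"
  define V where "V = (\<lambda>d. max (MAX i\<in>{1..nTR}. l i (?\<phi> d T))
            (MAX i\<in>{1..nX}. SUP s\<in>{t..T}. g i (?\<phi> d s) s))"
  obtain B where B: "\<And>d s. d \<in> controls D T t \<Longrightarrow> s \<in> {t..T} \<Longrightarrow> norm (?\<phi> d s) \<le> B"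
    using solution_bounded by blast
  have "\<exists>c. \<forall>y\<in>cball 0 B. \<forall>s\<in>{t..T}. g i y s \<le> c" if i: "i \<in> {1..nX}" for i
  proof -
    have "compact ((\<lambda>(x, s). g i x s) ` (cball 0 B \<times> {t..T}))"
      by (intro compact_continuous_image continuous_on_subset[OF g[OF i]] compact_Times) auto
    then have "bdd_above ((\<lambda>(x, s). g i x s) ` (cball 0 B \<times> {t..T}))"
      by (intro bounded_imp_bdd_above compact_imp_bounded)
    then obtain c where "\<And>v. v \<in> (\<lambda>(x, s). g i x s) ` (cball 0 B \<times> {t..T}) \<Longrightarrow> v \<le> c"
      by (elim bdd_above.E) (rule that, assumption)
    then show ?thesis by fastforce
  qed
  then obtain G where G: "\<And>i y s. i \<in> {1..nX} \<Longrightarrow> norm y \<le> B \<Longrightarrow> s \<in> {t..T} \<Longrightarrow> g i y s \<le> G i"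
    unfolding mem_cball_0 Ball_def by metis
  have "\<exists>c. \<forall>y\<in>cball 0 B. l i y \<le> c" if i: "i \<in> {1..nTR}" for i
  proof -
    have "compact (l i ` cball 0 B)"
      by (intro compact_continuous_image continuous_on_subset[OF l[OF i]]) auto
    then have "bdd_above (l i ` cball 0 B)"
      by (intro bounded_imp_bdd_above compact_imp_bounded)
    then show ?thesis unfolding bdd_above_def by blast
  qed
  then obtain H where H: "\<And>i y. i \<in> {1..nTR} \<Longrightarrow> norm y \<le> B \<Longrightarrow> l i y \<le> H i"
    unfolding mem_cball_0 Ball_def by metis
  \<comment> \<open>A general \<open>c\<close> because it is used twice: with a bound independent of
    \<open>d\<close>, to show the family of costs bounded above, and with 0.\<close>
  have V_le_iff: "V d \<le> c \<longleftrightarrow> (\<forall>i\<in>{1..nTR}. l i (?\<phi> d T) \<le> c) \<and>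
      (\<forall>i\<in>{1..nX}. \<forall>s\<in>{t..T}. g i (?\<phi> d s) s \<le> c)" if d: "d \<in> controls D T t" for d c
  proof -
    have "(SUP s\<in>{t..T}. g i (?\<phi> d s) s) \<le> c \<longleftrightarrow> (\<forall>s\<in>{t..T}. g i (?\<phi> d s) s \<le> c)"
      if i: "i \<in> {1..nX}" for i
    proof (rule cSUP_le_iff)
      show "bdd_above ((\<lambda>s. g i (?\<phi> d s) s) ` {t..T})"
        using G[OF i B[OF d]] by (intro bdd_aboveI[of _ "G i"]) auto
    qed (use t_le in simp)
    then show ?thesis
      \<comment> \<open>Both index ranges are nonempty, so \<open>MAX\<close> unfolds to a condition
        on each index.\<close>
      unfolding V_def using assms(1,2) by simp
  qed
  have "V d \<le> max (Max (H ` {1..nTR})) (Max (G ` {1..nX}))" if d: "d \<in> controls D T t" for d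
    unfolding V_le_iff[OF d]
  proof (intro conjI ballI)
    show "l i (?\<phi> d T) \<le> max (Max (H ` {1..nTR})) (Max (G ` {1..nX}))" if i: "i \<in> {1..nTR}" for i
    proof -
      have "H i \<le> Max (H ` {1..nTR})" using i by simp
      then show ?thesis using H[OF i B[OF d, of T]] t_le by simp
    qed
    show "g i (?\<phi> d s) s \<le> max (Max (H ` {1..nTR})) (Max (G ` {1..nX}))"
      if i: "i \<in> {1..nX}" and s: "s \<in> {t..T}" for i s
    proof -
      have "G i \<le> Max (G ` {1..nX})" using i by simp
      then show ?thesis using G[OF i B[OF d s] s] by simp
    qed
  qed
  then have "bdd_above (V ` controls D T t)" by (rule bdd_aboveI2)
  then have "(SUP d\<in>controls D T t. V d) \<le> 0 \<longleftrightarrow> (\<forall>d\<in>controls D T t. V d \<le> 0)"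
    by (rule cSUP_le_iff[OF controls_nonempty])
  moreover have "value_function F D T nX g nTR l x t = (SUP d\<in>controls D T t. V d)"
    by (simp add: value_function_def V_def)
  ultimately show ?thesis
    using V_le_iff[of _ 0] by (auto simp: constraint_set_def target_set_def)
qed

lemma is_solution_cong_field:
  assumes d: "d \<in> controls D T t" and eq: "\<And>s e. s \<in> {t..T} \<Longrightarrow> e \<in> D \<Longrightarrow> f (y s) e = F (y s) e"
  shows "is_solution f T x t d y \<longleftrightarrow> is_solution F T x t d y"
proof -
  have "(AE s in lebesgue_on {t..T}. (y has_vector_derivative f (y s) (d s)) (at s within {t..T})) \<longleftrightarrow>
      (AE s in lebesgue_on {t..T}. (y has_vector_derivative F (y s) (d s)) (at s within {t..T}))"
    by (rule AE_cong) (simp add: eq controls_in[OF d])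
  then show ?thesis by (simp add: is_solution_def)
qed

text \<open>A viable curve meets only points where the fields agree. Left to right, uniqueness
  identifies it with the auxiliary solution; right to left, the auxiliary solution itself witnesses
  existence for \<open>f\<close>.\<close>

lemma viable_solution_iff:
  assumes d: "d \<in> controls D T t" and eq: "\<And>s y e. s \<in> {t..T} \<Longrightarrow> y \<in> X s \<Longrightarrow> e \<in> D \<Longrightarrow> f y e = F y e"
  shows "(\<exists>y. is_solution f T x t d y \<and> (\<forall>s\<in>{t..T}. y s \<in> X s) \<and> y T \<in> TR) \<longleftrightarrow>
    (\<forall>s\<in>{t..T}. solution F T x t d s \<in> X s) \<and> solution F T x t d T \<in> TR"
    (is "?ex \<longleftrightarrow> ?viable")
proof
  assume ?ex
  then obtain y where y: "is_solution f T x t d y" "\<forall>s\<in>{t..T}. y s \<in> X s" "y T \<in> TR" by blast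
  have "is_solution F T x t d y"
    using y(1,2) is_solution_cong_field[OF d, of f y x] eq by blast
  then have same: "solution F T x t d s = y s" if "s \<in> {t..T}" for s
    using is_solution_unique[OF d is_solution_solution[OF d] _ that] by blast
  show ?viable using y t_le by (simp add: same)
next
  assume ?viable
  moreover from this have "is_solution f T x t d (solution F T x t d)"
    using is_solution_cong_field[OF d, of f "solution F T x t d" x] eq is_solution_solution[OF d] by blast
  ultimately show ?ex by blast
qed

end

section \<open>The backward reachable set\<close>

theorem proposition1:
  fixes f F :: "real ^ 'n \<Rightarrow> real ^ 'm \<Rightarrow> real ^ 'n"
    and D :: "(real ^ 'm) set"
    and g :: "nat \<Rightarrow> real ^ 'n \<Rightarrow> real \<Rightarrow> real"
    and l :: "nat \<Rightarrow> real ^ 'n \<Rightarrow> real"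
    and nX nTR :: nat
    and T R :: real
  assumes T_pos: "T > 0"
    and f_poly: "\<And>i. real_polynomial_function (\<lambda>(x, d). f x d $ i)"
    and D_nonempty: "D \<noteq> {}"
    and D_compact: "compact D"
    and D_semialgebraic: "basic_semialgebraic D"
    and nX_pos: "nX \<ge> 1"
    and g_poly: "\<And>i. i \<in> {1..nX} \<Longrightarrow> real_polynomial_function (\<lambda>(x, t). g i x t)"
    and X_compact: "\<And>t. t \<in> {0..T} \<Longrightarrow> compact (constraint_set nX g t)"
    and X_frontier: "\<And>t. t \<in> {0..T} \<Longrightarrow>
          frontier (constraint_set nX g t) = (\<Union>i\<in>{1..nX}. {x \<in> constraint_set nX g t. g i x t = 0})"
    and nTR_pos: "nTR \<ge> 1"
    and l_poly: "\<And>i. i \<in> {1..nTR} \<Longrightarrow> real_polynomial_function (l i)"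
    and TR_frontier:
          "frontier (target_set nTR l) = (\<Union>i\<in>{1..nTR}. {x \<in> target_set nTR l. l i x = 0})"
    and R_pos: "R > 0"
    and X_in_ball: "\<And>t. t \<in> {0..T} \<Longrightarrow> constraint_set nX g t \<subseteq> enclosing_ball R"
    and X_ball_frontiers: "\<And>t. t \<in> {0..T} \<Longrightarrow>
          frontier (constraint_set nX g t) \<inter> frontier (enclosing_ball R) = {}"
    and F_continuous: "continuous_on (UNIV \<times> D) (\<lambda>(x, d). F x d)"
    and F_lipschitz: "\<exists>L. \<forall>d\<in>D. L-lipschitz_on UNIV (\<lambda>x. F x d)"
    and F_eq_f: "\<And>x d. x \<in> enclosing_ball R \<Longrightarrow> d \<in> D \<Longrightarrow> F x d = f x d"
  shows "\<forall>t\<in>{0..T}. backward_reachable f D T (constraint_set nX g) (target_set nTR l) t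
           = {x. value_function F D T nX g nTR l x t \<le> 0}"
proof
  fix t assume t: "t \<in> {0..T}"
  obtain L where L: "\<forall>d\<in>D. L-lipschitz_on UNIV (\<lambda>x. F x d)" using F_lipschitz by blast
  interpret lipschitz_control_system F D L T t
    using D_nonempty D_compact F_continuous L t by unfold_locales auto
  have g: "continuous_on UNIV (\<lambda>(x, s). g i x s)" if "i \<in> {1..nX}" for i
    using g_poly[OF that] by (simp add: continuous_at_imp_continuous_on continuous_real_polymonial_function)
  have l: "continuous_on UNIV (l i)" if "i \<in> {1..nTR}" for i
    using l_poly[OF that] by (simp add: continuous_at_imp_continuous_on continuous_real_polymonial_function)
  have viable: "(\<exists>y. is_solution f T x t d y \<and> (\<forall>s\<in>{t..T}. y s \<in> constraint_set nX g s) \<and> y T \<in> target_set nTR l) \<longleftrightarrow>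
      (\<forall>s\<in>{t..T}. solution F T x t d s \<in> constraint_set nX g s) \<and> solution F T x t d T \<in> target_set nTR l"
    if "d \<in> controls D T t" for x d
  proof (rule viable_solution_iff[OF that])
    \<comment> \<open>Since \<open>t\<close> is nonnegative, \<open>s\<close> lies in
      \<open>[0,T]\<close>, where the constraint set is contained in the ball.\<close>
    show "f y e = F y e" if "s \<in> {t..T}" "y \<in> constraint_set nX g s" "e \<in> D" for s y e
      using that t X_in_ball[of s] F_eq_f[of y e] by auto
  qed
  have val: "value_function F D T nX g nTR l x t \<le> 0 \<longleftrightarrow>
      (\<forall>d\<in>controls D T t. (\<forall>s\<in>{t..T}. solution F T x t d s \<in> constraint_set nX g s) \<and>
         solution F T x t d T \<in> target_set nTR l)" for x
    by (rule value_function_le_0_iff[OF nX_pos nTR_pos g l])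
  show "backward_reachable f D T (constraint_set nX g) (target_set nTR l) t
      = {x. value_function F D T nX g nTR l x t \<le> 0}"
    by (simp add: backward_reachable_def val viable)
qed

end
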